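(* Let $\mathcal{F}$ be the family of all concept classes with Littlestone dimension $d$. For $T\ge 2^{d+1}$, in (realizable) transductive online learning over $T$ rounds with access to the ERM oracle, any deterministic algorithm that makes fewer than $T/2$ queries will make (in the worst case) at least $2^{d}-1$ mistakes.
   Context: Transductive online learning with oracle access (realizable setting). Concept classes are sets $\mathcal{C}\subseteq\{0,1\}^{\mathcal{X}}$, where $\mathcal{X}$ is the instance space. The family $\mathcal{F}$ is known to the learner. The adversary chooses an unknown $\mathcal{C}\in\mathcal{F}$, a target $c\in\mathcal{C}$ and a sequence $x_{1:T}\in\mathcal{X}^T$. The whole sequence $x_{1:T}$ is revealed to the learner at the start. The learner can access $\mathcal{C}$ only through an oracle. In round $t=1,\dots,T$ the (deterministic) learner predicts $\hat y_t\in\{0,1\}$, then $y_t=c(x_t)$ is revealed; a mistake occurs if $\hat y_t\neq y_t$. Worst case means over $\mathcal{C}\in\mathcal{F}$, $c\in\mathcal{C}$, $x_{1:T}\in\mathcal{X}^T$ and over valid oracle answers. ERM oracle: given any subset $S\subset\mathcal{X}\times\{0,1\}$, if some concept in $\mathcal{C}$ is consistent with $S$ it returns some such concept of $\mathcal{C}$; otherwise it returns "not realizable". Littlestone dimension of $\mathcal{C}$: the largest depth $n$ of a complete binary tree whose internal nodes are labeled by points of $\mathcal{X}$ such that for every root-to-leaf path, with edge labels $y_1,\dots,y_n\in\{0,1\}$ and visited nodes $x_1,\dots,x_n$, some $c\in\mathcal{C}$ has $c(x_i)=y_i$ for all $i$.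
   Formalization: The instance space X is assumed to be infinite or to have at least T points; without such an assumption the claim fails (e.g. |X|=2, d=2, T=8, where remembering labels gives at most 2 < 3 mistakes). *)

theory Defs imports Complex_Main begin

type_synonym 'x concept = "'x \<Rightarrow> bool"

text \<open>
  The instance space is the type \<open>'x\<close>. A complete binary tree of depth \<open>n\<close> with internal nodes
  labelled by instances is a function on bit lists of length less than \<open>n\<close>: an internal node is
  addressed by the list of edge labels on the path leading to it from the root.
\<close>

definition shatters :: "'x concept set \<Rightarrow> (bool list \<Rightarrow> 'x) \<Rightarrow> nat \<Rightarrow> bool" where
  "shatters C z n \<longleftrightarrow>
     (\<forall>ys. length ys = n \<longrightarrow> (\<exists>c\<in>C. \<forall>i<n. c (z (take i ys)) = ys ! i))"

text \<open>A relation rather than a number: the dimension may be infinite, and the empty class,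
  which does not shatter even the tree of depth 0, has none.\<close>

definition has_littlestone_dim :: "'x concept set \<Rightarrow> nat \<Rightarrow> bool" where
  "has_littlestone_dim C d \<longleftrightarrow>
     (\<exists>z. shatters C z d) \<and> (\<forall>n. (\<exists>z. shatters C z n) \<longrightarrow> n \<le> d)"

definition consistent :: "'x concept \<Rightarrow> ('x \<times> bool) set \<Rightarrow> bool" where
  "consistent c S \<longleftrightarrow> (\<forall>(x, y)\<in>S. c x = y)"

text \<open>\<open>None\<close> is the answer ``not realizable''.\<close>

definition erm_oracle ::
    "'x concept set \<Rightarrow> (('x \<times> bool) set \<Rightarrow> 'x concept option) \<Rightarrow> bool" where
  "erm_oracle C orc \<longleftrightarrow>
     (\<forall>S. case orc S of
            Some c \<Rightarrow> c \<in> C \<and> consistent c S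
          | None \<Rightarrow> \<not> (\<exists>c\<in>C. consistent c S))"

datatype 'x action = Query "('x \<times> bool) set" | Predict bool

text \<open>\<open>Answered S a\<close>: the query \<open>S\<close> got the answer \<open>a\<close>.
  \<open>Revealed p y\<close>: the learner predicted \<open>p\<close>, then the true label \<open>y\<close> was revealed.\<close>

datatype 'x event = Answered "('x \<times> bool) set" "'x concept option" | Revealed bool bool

text \<open>A deterministic learner chooses its next action from the full instance sequence and the
  transcript so far. It may put any number of queries to the oracle before each prediction.\<close>

type_synonym 'x learner = "'x list \<Rightarrow> 'x event list \<Rightarrow> 'x action"

definition rounds :: "'x event list \<Rightarrow> nat" where
  "rounds h = length (filter (\<lambda>e. \<exists>p y. e = Revealed p y) h)"

definition num_queries :: "'x event list \<Rightarrow> nat" where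
  "num_queries h = length (filter (\<lambda>e. \<exists>S a. e = Answered S a) h)"

definition num_mistakes :: "'x event list \<Rightarrow> nat" where
  "num_mistakes h = length (filter (\<lambda>e. \<exists>p y. e = Revealed p y \<and> p \<noteq> y) h)"

text \<open>The (finite, possibly partial) transcripts arising when learner \<open>L\<close> plays on the
  sequence \<open>xs\<close> with target \<open>c\<close> and oracle \<open>orc\<close>, in chronological order.\<close>

inductive transcript ::
    "'x learner \<Rightarrow> (('x \<times> bool) set \<Rightarrow> 'x concept option) \<Rightarrow> 'x concept \<Rightarrow> 'x list
       \<Rightarrow> 'x event list \<Rightarrow> bool"
  for L orc c xs where
  start: "transcript L orc c xs []"
| query: "transcript L orc c xs h \<Longrightarrow> rounds h < length xs \<Longrightarrow> L xs h = Query S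
    \<Longrightarrow> transcript L orc c xs (h @ [Answered S (orc S)])"
| predict: "transcript L orc c xs h \<Longrightarrow> rounds h < length xs \<Longrightarrow> L xs h = Predict p
    \<Longrightarrow> transcript L orc c xs (h @ [Revealed p (c (xs ! rounds h))])"

text \<open>An admissible choice of the adversary over \<open>T\<close> rounds, for the family of all concept classes
  of Littlestone dimension \<open>d\<close>.\<close>

definition admissible ::
    "nat \<Rightarrow> nat \<Rightarrow> 'x concept set \<Rightarrow> (('x \<times> bool) set \<Rightarrow> 'x concept option) \<Rightarrow> 'x concept
       \<Rightarrow> 'x list \<Rightarrow> bool" where
  "admissible d T C orc c xs \<longleftrightarrow>
     has_littlestone_dim C d \<and> erm_oracle C orc \<and> c \<in> C \<and> length xs = T"

text \<open>Partial transcripts are included, so a learner that goes on querying forever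
  in some round does not satisfy any such bound.\<close>

definition makes_fewer_queries_than :: "'x learner \<Rightarrow> nat \<Rightarrow> nat \<Rightarrow> real \<Rightarrow> bool" where
  "makes_fewer_queries_than L d T q \<longleftrightarrow>
     (\<forall>C orc c xs h. admissible d T C orc c xs \<longrightarrow> transcript L orc c xs h \<longrightarrow>
        real (num_queries h) < q)"

definition worst_case_mistakes_at_least :: "'x learner \<Rightarrow> nat \<Rightarrow> nat \<Rightarrow> nat \<Rightarrow> bool" where
  "worst_case_mistakes_at_least L d T m \<longleftrightarrow>
     (\<exists>C orc c xs h. admissible d T C orc c xs \<and> transcript L orc c xs h \<and>
        rounds h = T \<and> num_mistakes h \<ge> m)"

end

theory Submission imports Defs begin

text \<open>
  The adversary plays distinct instances and uses a chain of \<open>2 ^ d\<close> concepts, the indicators of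
  the prefixes of a list \<open>A\<close> of \<open>2 ^ d - 1\<close> distinct points, which it builds during the game.
  A query that demands the label 1 at a point not yet in \<open>A\<close> is declared not realizable, and this
  single point is discarded: it will never enter \<open>A\<close>. All other queries can be answered from the
  current \<open>A\<close> in a way that later extensions of \<open>A\<close> do not affect. At a point not discarded the
  adversary reveals the label opposite to the prediction, and appends the point to \<open>A\<close> if this
  label is 1. Fewer than \<open>T / 2\<close> points are discarded, so the remaining ones suffice both for
  \<open>2 ^ d - 1\<close> mistakes and for completing \<open>A\<close> to its full length. Binary search shows that the
  final chain has Littlestone dimension \<open>d\<close>.
\<close>

section \<open>Littlestone dimension of a chain of concepts\<close>

text \<open>Label sequences that agree on a prefix address the same node next, so a concept
  realizing both gives them the same next label. Distinct sequences therefore need distinct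
  concepts.\<close>

lemma shatters_card:
  assumes "shatters C z n" "finite C"
  shows "2 ^ n \<le> card C"
proof -
  let ?Y = "{ys :: bool list. set ys \<subseteq> UNIV \<and> length ys = n}"
  obtain f where f: "\<And>ys. length ys = n \<Longrightarrow> f ys \<in> C \<and> (\<forall>i<n. f ys (z (take i ys)) = ys ! i)"
    using assms(1) unfolding shatters_def by metis
  have "inj_on f ?Y"
  proof (rule inj_onI)
    fix ys ys' assume ys: "ys \<in> ?Y" "ys' \<in> ?Y" and eq: "f ys = f ys'"
    have "take i ys = take i ys'" if "i \<le> n" for i
      using that
    proof (induction i)
      case (Suc i)
      then have eq': "take i ys = take i ys'" and "i < n" by simp_all
      have "ys ! i = f ys (z (take i ys))" using f[of ys] ys \<open>i < n\<close> by simp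
      also have "\<dots> = ys' ! i" using f[of ys'] ys \<open>i < n\<close> eq eq' by simp
      finally have "ys ! i = ys' ! i" .
      with eq' show ?case using Suc.prems ys by (simp add: take_Suc_conv_app_nth)
    qed simp
    from this[of n] show "ys = ys'" using ys by simp
  qed
  moreover have "f ` ?Y \<subseteq> C" using f by auto
  ultimately have "card ?Y \<le> card C" using assms(2) by (metis card_inj_on_le)
  then show ?thesis using card_lists_length_eq[of "UNIV :: bool set" n] by simp
qed

lemma shatters_Suc:
  assumes "shatters {c \<in> C. \<not> c x} z0 n" "shatters {c \<in> C. c x} z1 n"
  shows "shatters C (\<lambda>bs. case bs of [] \<Rightarrow> x | b # bs' \<Rightarrow> if b then z1 bs' else z0 bs') (Suc n)"
  unfolding shatters_def
proof (intro allI impI)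
  fix ys :: "bool list" assume "length ys = Suc n"
  then obtain b bs where ys: "ys = b # bs" "length bs = n" by (cases ys) auto
  have "\<exists>c\<in>{c \<in> C. c x = b}. \<forall>i<n. c ((if b then z1 else z0) (take i bs)) = bs ! i"
    using assms ys(2) unfolding shatters_def by (cases b) simp_all
  then obtain c where c: "c \<in> C" "c x = b"
      "\<And>i. i < n \<Longrightarrow> c ((if b then z1 else z0) (take i bs)) = bs ! i"
    by blast
  have "c (case take i ys of [] \<Rightarrow> x | b # bs' \<Rightarrow> if b then z1 bs' else z0 bs') = ys ! i"
    if "i < Suc n" for i
    using that c(2) c(3)[of "i - 1"] by (cases i) (simp_all add: ys(1) split: if_splits)
  with c(1) show "\<exists>c\<in>C. \<forall>i<Suc n. c (case take i ys of [] \<Rightarrow> x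
      | b # bs' \<Rightarrow> if b then z1 bs' else z0 bs') = ys ! i"
    by blast
qed

text \<open>Binary search: the middle point splits the concepts into two halves of equal size, each
  again a run of thresholds, and the trees of the halves are grafted below that point.\<close>

lemma thresholds_shatter:
  fixes a :: "nat \<Rightarrow> 'x" and t :: "nat \<Rightarrow> 'x concept"
  assumes "\<And>j. lo \<le> j \<Longrightarrow> j < lo + 2 ^ n \<Longrightarrow> t j \<in> C"
    and "\<And>i j. lo \<le> i \<Longrightarrow> Suc i < lo + 2 ^ n \<Longrightarrow> lo \<le> j \<Longrightarrow> j < lo + 2 ^ n \<Longrightarrow> t j (a i) = (i < j)"
  shows "\<exists>z. shatters C z n"
  using assms
proof (induction n arbitrary: lo C)
  case 0
  then show ?case by (auto simp: shatters_def intro!: bexI[of _ "t lo"])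
next
  case (Suc n)
  \<comment> \<open>The last index of the lower half: \<open>t j (a mid)\<close> is false on the
    first \<open>2 ^ n\<close> indices and true on the others.\<close>
  define mid where "mid = lo + 2 ^ n - 1"
  have pos: "(1::nat) \<le> 2 ^ n" by simp
  have mid: "lo \<le> mid" "Suc mid = lo + 2 ^ n" using pos unfolding mid_def by linarith+
  have "\<exists>z. shatters {c \<in> C. \<not> c (a mid)} z n"
    by (rule Suc.IH[of lo]) (use Suc.prems mid pos in auto)
  moreover have "\<exists>z. shatters {c \<in> C. c (a mid)} z n"
    by (rule Suc.IH[of "Suc mid"]) (use Suc.prems mid pos in auto)
  ultimately show ?case by (elim exE) (rule exI, rule shatters_Suc)
qed

text \<open>All indices from \<open>length A\<close> on give the full \<open>set A\<close>, so the
  range over all naturals is still a finite chain.\<close>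

definition prefix_concept :: "'x list \<Rightarrow> nat \<Rightarrow> 'x concept" where
  "prefix_concept A j = (\<lambda>x. x \<in> set (take j A))"

text \<open>The entries of \<open>A\<close> serve as thresholds for the lower bound; the upper bound
  holds because the chain has at most \<open>2 ^ d\<close> members.\<close>

lemma has_littlestone_dim_prefix_concepts:
  assumes "distinct A" "length A = 2 ^ d - 1"
  shows "has_littlestone_dim (range (prefix_concept A)) d"
  unfolding has_littlestone_dim_def
proof (intro conjI allI impI)
  have "prefix_concept A j (A ! i) = (i < j)" if "Suc i < 2 ^ d" "j < 2 ^ d" for i j
    using that assms
    by (auto simp: prefix_concept_def in_set_conv_nth nth_eq_iff_index_eq)
  then show "\<exists>z. shatters (range (prefix_concept A)) z d"
    by (intro thresholds_shatter[where lo = 0 and t = "prefix_concept A" and a = "nth A"]) auto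
next
  fix n assume "\<exists>z. shatters (range (prefix_concept A)) z n"
  then obtain z where z: "shatters (range (prefix_concept A)) z n" ..
  have "prefix_concept A j = prefix_concept A (min j (length A))" for j
    by (simp add: prefix_concept_def min_def)
  then have "range (prefix_concept A) \<subseteq> prefix_concept A ` {..length A}"
    by (metis atMost_iff image_eqI image_subsetI min.cobounded2)
  then have sub: "range (prefix_concept A) = prefix_concept A ` {..length A}" by blast
  have "2 ^ n \<le> card (range (prefix_concept A))"
    using z by (rule shatters_card) (simp add: sub)
  also have "\<dots> \<le> card {..length A}" unfolding sub by (rule card_image_le) simp
  also have "\<dots> = 2 ^ d" using assms(2) by simp
  finally show "n \<le> d" by (simp add: power_increasing_iff)
qed

section \<open>Oracle answers that survive an extension of the list\<close>

text \<open>Taking the shortest consistent prefix is what allows an answer to stay the same when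
  \<open>A\<close> grows.\<close>

definition prefix_erm :: "'x list \<Rightarrow> ('x \<times> bool) set \<Rightarrow> 'x concept option" where
  "prefix_erm A S = (if \<exists>j. consistent (prefix_concept A j) S
     then Some (prefix_concept A (LEAST j. consistent (prefix_concept A j) S)) else None)"

lemma erm_oracle_prefix_erm: "erm_oracle (range (prefix_concept A)) (prefix_erm A)"
  unfolding erm_oracle_def prefix_erm_def by (auto intro: LeastI)

text \<open>A label 1 demanded outside the longer list makes both answers \<open>None\<close>. If
  all points with label 1 lie in \<open>A\<close>, a shortest consistent prefix is no longer than
  \<open>A\<close>, and up to there both lists have the same prefixes.\<close>

lemma prefix_erm_append:
  assumes "(\<exists>x. (x, True) \<in> S \<and> x \<notin> set (A @ B)) \<or> (\<forall>x. (x, True) \<in> S \<longrightarrow> x \<in> set A)"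
  shows "prefix_erm (A @ B) S = prefix_erm A S"
proof (cases "\<forall>x. (x, True) \<in> S \<longrightarrow> x \<in> set A")
  case False
  then obtain x where "(x, True) \<in> S" "x \<notin> set (A @ B)" using assms by blast
  then have "\<not> consistent (prefix_concept (A @ B) j) S" "\<not> consistent (prefix_concept A j) S" for j
    by (auto simp: consistent_def prefix_concept_def dest!: in_set_takeD)
  then show ?thesis by (simp add: prefix_erm_def)
next
  case True
  have eq: "prefix_concept (A @ B) j = prefix_concept A j" if "j \<le> length A" for j
    using that by (simp add: prefix_concept_def)
  \<comment> \<open>A consistent prefix reaching past \<open>A\<close> can be cut back to
    \<open>A\<close>: points labelled 1 lie in \<open>A\<close>, and points labelled 0 avoid even
    the larger set.\<close>
  have full: "consistent (prefix_concept A (length A)) S"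
    if "consistent (prefix_concept (A @ B) j) S" "length A < j" for j
    using that True by (fastforce simp: consistent_def prefix_concept_def)
  have full': "consistent (prefix_concept A (length A)) S"
    if "consistent (prefix_concept A j) S" "length A < j" for j
    using that by (simp add: prefix_concept_def)
  show ?thesis
  proof (cases "\<exists>j. consistent (prefix_concept A j) S")
    case False
    then have "\<not> consistent (prefix_concept (A @ B) j) S" for j
      using eq full by (metis not_le)
    with False show ?thesis by (simp add: prefix_erm_def)
  next
    case True
    define j0 where "j0 = (LEAST j. consistent (prefix_concept A j) S)"
    have j0: "consistent (prefix_concept A j0) S" unfolding j0_def using True by (rule LeastI_ex)
    have least: "j0 \<le> j" if "consistent (prefix_concept A j) S" for j
      unfolding j0_def using that by (rule Least_le)
    have len: "j0 \<le> length A" using full' j0 least by (metis not_le)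
    have "(LEAST j. consistent (prefix_concept (A @ B) j) S) = j0"
      by (rule Least_equality) (use j0 len eq least in \<open>auto, metis le_cases le_trans\<close>)
    moreover have "\<exists>j. consistent (prefix_concept (A @ B) j) S" using j0 len eq by metis
    ultimately show ?thesis using True len eq unfolding prefix_erm_def j0_def[symmetric] by simp
  qed
qed

section \<open>The invariant of the adversary and its moves\<close>

lemma event_counts [simp]:
  "rounds [] = 0" "num_queries [] = 0" "num_mistakes [] = 0"
  "rounds (h @ [Answered S a]) = rounds h"
  "rounds (h @ [Revealed p y]) = Suc (rounds h)"
  "num_queries (h @ [Answered S a]) = Suc (num_queries h)"
  "num_queries (h @ [Revealed p y]) = num_queries h"
  "num_mistakes (h @ [Answered S a]) = num_mistakes h"
  "num_mistakes (h @ [Revealed p y]) = num_mistakes h + (if p = y then 0 else 1)"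
  by (simp_all add: rounds_def num_queries_def num_mistakes_def)

lemma rounds_plus_queries: "length h = rounds h + num_queries h"
proof (induction h rule: rev_induct)
  case (snoc e h)
  then show ?case by (cases e) simp_all
qed simp

text \<open>\<open>D\<close> is the set of discarded points. The last conjunct says that the transcript stays valid
  for every later extension of \<open>A\<close> avoiding \<open>D\<close>.\<close>

definition adversary_state ::
    "'x learner \<Rightarrow> 'x list \<Rightarrow> nat \<Rightarrow> 'x event list \<Rightarrow> 'x list \<Rightarrow> 'x set \<Rightarrow> bool" where
  "adversary_state L xs m h A D \<longleftrightarrow>
     rounds h \<le> length xs \<and> distinct A \<and> set A \<subseteq> set (take (rounds h) xs) \<and> set A \<inter> D = {} \<and>
     length A \<le> m \<and> length A \<le> num_mistakes h \<and> finite D \<and> card D \<le> num_queries h \<and>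
     (m \<le> num_mistakes h \<or> card (set (take (rounds h) xs) - D) \<le> num_mistakes h) \<and>
     (\<forall>B c. set B \<inter> D = {} \<longrightarrow> (\<forall>x\<in>set (take (rounds h) xs). c x = (x \<in> set A)) \<longrightarrow>
        transcript L (prefix_erm (A @ B)) c xs h)"

text \<open>The query itself pays for the at most one point it discards. Later extensions avoid that
  point, so the answer given now remains correct.\<close>

lemma adversary_state_query:
  assumes st: "adversary_state L xs m h A D" and "rounds h < length xs" "L xs h = Query S"
  shows "\<exists>D'. adversary_state L xs m (h @ [Answered S (prefix_erm A S)]) A D'"
proof -
  obtain D' where D': "D \<subseteq> D'" "finite D'" "card D' \<le> Suc (card D)" "set A \<inter> D' = {}"
    and S: "(\<exists>x\<in>D'. (x, True) \<in> S) \<or> (\<forall>x. (x, True) \<in> S \<longrightarrow> x \<in> set A)"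
  proof (cases "\<forall>x. (x, True) \<in> S \<longrightarrow> x \<in> set A")
    case True
    then show ?thesis using that[of D] st by (simp add: adversary_state_def)
  next
    case False
    then obtain x where "(x, True) \<in> S" "x \<notin> set A" by blast
    moreover from this have "set A \<inter> insert x D = {}" "finite (insert x D)"
        "card (insert x D) \<le> Suc (card D)"
      using st by (auto simp: adversary_state_def card_insert_if)
    ultimately show ?thesis using that[of "insert x D"] by blast
  qed
  have valid: "\<forall>B c. set B \<inter> D = {} \<longrightarrow> (\<forall>x\<in>set (take (rounds h) xs). c x = (x \<in> set A)) \<longrightarrow>
      transcript L (prefix_erm (A @ B)) c xs h"
    using st by (simp add: adversary_state_def)
  have "transcript L (prefix_erm (A @ B)) c xs (h @ [Answered S (prefix_erm A S)])"
    if "set B \<inter> D' = {}" "\<forall>x\<in>set (take (rounds h) xs). c x = (x \<in> set A)" for B c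
  proof -
    have "set B \<inter> D = {}" using that(1) D'(1) by blast
    then have "transcript L (prefix_erm (A @ B)) c xs h"
      using valid that(2) by blast
    moreover have "prefix_erm (A @ B) S = prefix_erm A S"
      using S that(1) D'(4) by (intro prefix_erm_append) auto
    ultimately show ?thesis using transcript.query assms(2,3) by metis
  qed
  moreover have "card (set (take (rounds h) xs) - D') \<le> card (set (take (rounds h) xs) - D)"
    using D'(1) by (intro card_mono) auto
  ultimately show ?thesis
    using st D'(2-4) unfolding adversary_state_def by (intro exI[of _ D']) (simp, linarith)
qed

lemma adversary_state_predict:
  assumes st: "adversary_state L xs m h A D" and "distinct xs" "rounds h < length xs"
    and "L xs h = Predict p"
  shows "\<exists>y A'. adversary_state L xs m (h @ [Revealed p y]) A' D"
proof -
  define x where "x = xs ! rounds h"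
  \<comment> \<open>Label 1 is revealed only where it causes a mistake, hence
    \<open>length A\<close> stays below the mistake count; once \<open>m\<close> mistakes are
    reached, all labels are 0 and \<open>A\<close> stops growing.\<close>
  define y where "y \<longleftrightarrow> x \<notin> D \<and> num_mistakes h < m \<and> \<not> p"
  define A' where "A' = (if y then A @ [x] else A)"
  have set_take: "set (take (Suc (rounds h)) xs) = insert x (set (take (rounds h) xs))"
    using assms(3) by (simp add: take_Suc_conv_app_nth x_def)
  have "x \<notin> set (take (rounds h) xs)"
    using assms(2,3) by (auto simp: x_def in_set_conv_nth nth_eq_iff_index_eq)
  moreover from this have xA: "x \<notin> set A" using st by (auto simp: adversary_state_def)
  ultimately have A': "distinct A'" "set A' \<subseteq> set (take (Suc (rounds h)) xs)" "set A' \<inter> D = {}"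
      "length A' \<le> m" "length A' \<le> num_mistakes (h @ [Revealed p y])"
    using st unfolding A'_def set_take by (auto simp: adversary_state_def y_def)
  have "transcript L (prefix_erm (A' @ B)) c xs (h @ [Revealed p y])"
    if B: "set B \<inter> D = {}" and c: "\<forall>x\<in>set (take (Suc (rounds h)) xs). c x = (x \<in> set A')" for B c
  proof -
    have "c x = y" using c xA unfolding set_take A'_def by auto
    have agree: "\<forall>x\<in>set (take (rounds h) xs). c x = (x \<in> set A)"
      using c \<open>x \<notin> set (take (rounds h) xs)\<close> unfolding set_take A'_def by auto
    \<comment> \<open>Relative to the old state, the new point is the first entry of the extension;
      this is allowed since \<open>y\<close> implies that \<open>x\<close> is not in
      \<open>D\<close>.\<close>
    have "set ((if y then [x] else []) @ B) \<inter> D = {}" using B by (auto simp: y_def)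
    with st agree have "transcript L (prefix_erm (A @ ((if y then [x] else []) @ B))) c xs h"
      unfolding adversary_state_def by blast
    then have "transcript L (prefix_erm (A' @ B)) c xs h" by (simp add: A'_def split: if_splits)
    from transcript.predict[OF this assms(3,4)] show ?thesis
      using \<open>c x = y\<close> by (simp add: x_def)
  qed
  moreover have "m \<le> num_mistakes (h @ [Revealed p y]) \<or>
      card (set (take (Suc (rounds h)) xs) - D) \<le> num_mistakes (h @ [Revealed p y])"
  \<comment> \<open>Before \<open>m\<close> mistakes are reached, each undiscarded point costs the
    learner a mistake, so both sides grow together.\<close>
  proof (cases "m \<le> num_mistakes h")
    case False
    then have "card (set (take (rounds h) xs) - D) \<le> num_mistakes h"
      using st by (simp add: adversary_state_def)
    with False show ?thesis
      unfolding set_take y_def by (auto simp: insert_Diff_if card_insert_if)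
  qed simp
  ultimately have "adversary_state L xs m (h @ [Revealed p y]) A' D"
    using st A' assms(3) unfolding adversary_state_def by simp
  then show ?thesis by blast
qed

section \<open>From states of the adversary to admissible games\<close>

text \<open>Undiscarded instances complete \<open>A\<close> to full length. Those already labelled 0
  may be used too, since the target is the prefix that ends with \<open>A\<close>. The bound
  \<open>Suc (length xs)\<close> leaves room for one query beyond a count below half the
  rounds.\<close>

lemma adversary_state_admissible:
  assumes st: "adversary_state L xs (2 ^ d - 1) h A D" and "distinct xs"
    and "2 * num_queries h \<le> Suc (length xs)" "2 ^ (d + 1) \<le> length xs"
  shows "\<exists>C orc. admissible d (length xs) C orc (\<lambda>x. x \<in> set A) xs \<and>
    transcript L orc (\<lambda>x. x \<in> set A) xs h"
proof -
  have A: "set A \<subseteq> set xs - D" "distinct A" "length A \<le> 2 ^ d - 1" "finite D"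
      "card D \<le> num_queries h"
    using st by (auto simp: adversary_state_def dest: in_set_takeD)
  have "length xs - card D \<le> card (set xs - D)"
    using diff_card_le_card_Diff[of D "set xs"] A(4) distinct_card[OF assms(2)] by simp
  then have "2 ^ d - 1 \<le> card (set xs - D)" using assms(3,4) A(5) by simp
  then have "2 ^ d - 1 - length A \<le> card (set xs - D - set A)"
    using A(1) card_Diff_subset[of "set A" "set xs - D"] distinct_card[OF A(2)] by simp
  then obtain U where U: "U \<subseteq> set xs - D - set A" "card U = 2 ^ d - 1 - length A" "finite U"
    by (rule obtain_subset_with_card_n)
  then obtain B where B: "set B = U" "distinct B" using finite_distinct_list by metis
  have "length B = 2 ^ d - 1 - length A" using B U(2) distinct_card by metis
  then have "has_littlestone_dim (range (prefix_concept (A @ B))) d"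
    using A(2,3) B U(1) by (intro has_littlestone_dim_prefix_concepts) auto
  moreover have "(\<lambda>x. x \<in> set A) \<in> range (prefix_concept (A @ B))"
    by (rule range_eqI[of _ _ "length A"]) (simp add: prefix_concept_def)
  moreover have "transcript L (prefix_erm (A @ B)) (\<lambda>x. x \<in> set A) xs h"
  proof -
    have "\<forall>x\<in>set (take (rounds h) xs). (x \<in> set A) = (x \<in> set A)" by simp
    moreover have "set B \<inter> D = {}" using B(1) U(1) by blast
    ultimately show ?thesis using st unfolding adversary_state_def by (elim conjE allE impE)
  qed
  ultimately have "admissible d (length xs) (range (prefix_concept (A @ B))) (prefix_erm (A @ B))
      (\<lambda>x. x \<in> set A) xs \<and> transcript L (prefix_erm (A @ B)) (\<lambda>x. x \<in> set A) xs h"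
    unfolding admissible_def by (intro conjI erm_oracle_prefix_erm refl)
  then show ?thesis by (intro exI)
qed

text \<open>The query bound is assumed only for admissible games. So after each event the state is
  first completed to such a game under the weaker bound, and this restores the strict one.\<close>

lemma adversary_state_exists:
  assumes "distinct xs" "2 ^ (d + 1) \<le> length xs"
    and "makes_fewer_queries_than L d (length xs) (real (length xs) / 2)"
  shows "\<exists>h A D. adversary_state L xs (2 ^ d - 1) h A D \<and> 2 * num_queries h < length xs \<and>
    (rounds h = length xs \<or> length h = n)"
proof (induction n)
  case 0
  have "adversary_state L xs (2 ^ d - 1) [] [] {}"
    by (auto simp: adversary_state_def intro: transcript.start)
  moreover have "(0::nat) < 2 ^ (d + 1)" by simp
  then have "0 < length xs" using assms(2) by linarith
  ultimately show ?case by (intro exI[of _ "[]"] exI[of _ "{}"]) simp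
next
  case (Suc n)
  then obtain h A D where st: "adversary_state L xs (2 ^ d - 1) h A D"
    and q: "2 * num_queries h < length xs" and h: "rounds h = length xs \<or> length h = n" by blast
  show ?case
  proof (cases "rounds h = length xs")
    case True
    with st q show ?thesis by blast
  next
    case False
    with st have less: "rounds h < length xs" by (simp add: adversary_state_def)
    have "\<exists>e A' D'. adversary_state L xs (2 ^ d - 1) (h @ [e]) A' D'"
      using adversary_state_query[OF st less] adversary_state_predict[OF st assms(1) less]
      by (cases "L xs h") blast+
    then obtain e A' D' where st': "adversary_state L xs (2 ^ d - 1) (h @ [e]) A' D'" by blast
    have "2 * num_queries (h @ [e]) \<le> Suc (length xs)" using q by (cases e) auto
    from adversary_state_admissible[OF st' assms(1) this assms(2)]
    have "real (num_queries (h @ [e])) < real (length xs) / 2"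
      using assms(3) unfolding makes_fewer_queries_than_def by blast
    then have "2 * num_queries (h @ [e]) < length xs" by linarith
    with st' h False show ?thesis by (intro exI[of _ "h @ [e]"]) auto
  qed
qed

theorem theorem4p4:
  fixes L :: "'x learner" and d T :: nat
  assumes "infinite (UNIV :: 'x set) \<or> T \<le> card (UNIV :: 'x set)"
    and "T \<ge> 2 ^ (d + 1)"
    and "makes_fewer_queries_than L d T (real T / 2)"
  shows "worst_case_mistakes_at_least L d T (2 ^ d - 1)"
proof -
  obtain U :: "'x set" where "finite U" "card U = T"
    using assms(1) infinite_arbitrarily_large obtain_subset_with_card_n by metis
  then obtain xs :: "'x list" where xs: "distinct xs" "length xs = T"
    using finite_distinct_list distinct_card by metis
  have long: "2 ^ (d + 1) \<le> length xs"
    and few: "makes_fewer_queries_than L d (length xs) (real (length xs) / 2)"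
    using assms(2,3) xs(2) by simp_all
  obtain h A D where st: "adversary_state L xs (2 ^ d - 1) h A D"
    and q: "2 * num_queries h < length xs" and "rounds h = length xs \<or> length h = 2 * length xs"
    using adversary_state_exists[OF xs(1) long few, of "2 * length xs"] by blast
  \<comment> \<open>At most \<open>length xs\<close> rounds and fewer than half as many queries
    cannot add up to \<open>2 * length xs\<close> events, so the game is over.\<close>
  then have r: "rounds h = length xs"
    using rounds_plus_queries[of h] by (auto simp: adversary_state_def)
  have "2 ^ d - 1 \<le> num_mistakes h"
  \<comment> \<open>Otherwise every undiscarded point was a mistake, yet more than half of the
    instances, hence more than \<open>2 ^ d\<close>, are undiscarded.\<close>
  proof (rule ccontr)
    assume "\<not> 2 ^ d - 1 \<le> num_mistakes h"
    then have *: "card (set xs - D) \<le> num_mistakes h" "num_mistakes h < 2 ^ d - 1"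
        "finite D" "card D \<le> num_queries h"
      using st r by (simp_all add: adversary_state_def)
    then have "length xs - card D \<le> card (set xs - D)"
      using diff_card_le_card_Diff[of D "set xs"] distinct_card[OF xs(1)] by simp
    with * q long show False by simp
  qed
  moreover have "2 * num_queries h \<le> Suc (length xs)" using q by simp
  ultimately show ?thesis
    using adversary_state_admissible[OF st xs(1) _ long] r xs(2)
    unfolding worst_case_mistakes_at_least_def by blast
qed

end
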